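(* Let $K=3$. For any three distinct points $z_1,z_2,z_3\in\mathbb{R}^5$, the solutions $(x_1,x_2,x_3)$ of the algebraic system $$6x_k=\kappa\sum_{1\le j\le 3,\ j\ne k}|z_j-z_k|^{-3}x_j^3,\qquad x_k>0,\qquad k=1,2,3,$$ are always isolated (that is, every solution has a neighbourhood in $\mathbb{R}^3$ containing no other solution).
   Context: $\kappa>0$ is the constant $\kappa=\frac32\,15^{3/2}\,\frac{\int_{\mathbb{R}^5}W^{7/3}dx}{\|\Lambda W\|_{L^2}^2}$, where $W(x)=(1+|x|^2/15)^{-3/2}$ on $\mathbb{R}^5$ and $\Lambda W=\left(\frac32+x\cdot\nabla\right)W$. *)

theory Defs
  imports "HOL-Analysis.Analysis"
begin

definition W :: "real^5 \<Rightarrow> real" where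
  "W x = (1 + (norm x)\<^sup>2 / 15) powr (- 3 / 2)"

definition gradient :: "('a::real_inner \<Rightarrow> real) \<Rightarrow> 'a \<Rightarrow> 'a" where
  "gradient f x = (THE D. GDERIV f x :> D)"

definition Lambda :: "(real^5 \<Rightarrow> real) \<Rightarrow> real^5 \<Rightarrow> real" where
  "Lambda f x = 3 / 2 * f x + x \<bullet> gradient f x"

definition kappa :: real where
  "kappa = 3 / 2 * 15 powr (3 / 2) *
     (LINT x|lborel. W x powr (7 / 3)) / (LINT x|lborel. (Lambda W x)\<^sup>2)"

(* The points are indexed by a finite type 'k, so that their number is CARD('k). *)
definition solutions :: "('k::finite \<Rightarrow> real^5) \<Rightarrow> (real^'k) set" where
  "solutions z = {x. \<forall>k. 6 * x $ k =
       kappa * (\<Sum>j\<in>UNIV - {k}. norm (z j - z k) powi (-3) * (x $ j) ^ 3) \<and> x $ k > 0}"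

end

theory Submission
  imports Defs
begin

text \<open>
  The system has at most one positive solution, so its solution set is trivially discrete. Scaling
  by \<open>\<kappa> / 6\<close> turns the system into \<open>x = A x\<^sup>3\<close> (entrywise cube), where \<open>A\<close> is symmetric with zero
  diagonal and positive off-diagonal entries \<open>a, b, c\<close>; if \<open>\<kappa> \<le> 0\<close>, no solution exists at all.

  A solution \<open>x\<close> is a nonzero fixed vector of the matrix \<open>A diag(x\<^sup>2)\<close>. If \<open>y\<close> is another
  solution, then \<open>x\<^sub>j\<^sup>3 - y\<^sub>j\<^sup>3 = s\<^sub>j (x\<^sub>j - y\<^sub>j)\<close> with \<open>s\<^sub>j = x\<^sub>j\<^sup>2 + x\<^sub>j y\<^sub>j + y\<^sub>j\<^sup>2\<close>, so \<open>x - y\<close> is a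
  nonzero fixed vector of \<open>A diag(s)\<close>. Hence \<open>det (I - A diag(t))\<close> vanishes both at \<open>t = x\<^sup>2\<close>
  and at \<open>t = s\<close> (\<open>coupling_det_eq_0\<close>). Because \<open>A\<close> has zero diagonal and size three, every
  nonconstant term of this determinant has a negative coefficient, so it is strictly decreasing
  for positive \<open>t\<close> (\<open>coupling_det_strict_antimono\<close>). But \<open>s > x\<^sup>2\<close> entrywise by positivity, a
  contradiction (\<open>cubic_system_unique\<close>).
\<close>

text \<open>The determinant of \<open>I - A diag(s, t, u)\<close>, where \<open>A\<close> is symmetric with zero diagonal and
  \<open>A\<^sub>1\<^sub>2 = a\<close>, \<open>A\<^sub>1\<^sub>3 = b\<close>, \<open>A\<^sub>2\<^sub>3 = c\<close>.\<close>

definition coupling_det :: "real \<Rightarrow> real \<Rightarrow> real \<Rightarrow> real \<Rightarrow> real \<Rightarrow> real \<Rightarrow> real" where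
  "coupling_det a b c s t u =
     1 - (a\<^sup>2 * (s * t) + b\<^sup>2 * (s * u) + c\<^sup>2 * (t * u)) - 2 * a * b * c * (s * t * u)"

text \<open>The identities multiply the three equations by the rows of the adjugate of
  \<open>I - A diag(s, t, u)\<close>.\<close>

lemma coupling_det_eq_0:
  assumes 1: "p = a * (t * q) + b * (u * r)"
    and 2: "q = a * (s * p) + c * (u * r)"
    and 3: "r = b * (s * p) + c * (t * q)"
    and nz: "p \<noteq> 0 \<or> q \<noteq> 0 \<or> r \<noteq> 0"
  shows "coupling_det a b c s t u = 0"
proof -
  define e f g where "e = p - (a * (t * q) + b * (u * r))"
    and "f = q - (a * (s * p) + c * (u * r))"
    and "g = r - (b * (s * p) + c * (t * q))"
  have z: "e = 0" "f = 0" "g = 0"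
    unfolding e_def f_def g_def using 1 2 3 by linarith+
  have "coupling_det a b c s t u * p =
      (1 - c\<^sup>2 * t * u) * e + (a * t + b * c * t * u) * f + (b * u + a * c * t * u) * g"
    unfolding coupling_det_def e_def f_def g_def by (simp add: algebra_simps power2_eq_square)
  moreover have "coupling_det a b c s t u * q =
      (a * s + b * c * s * u) * e + (1 - b\<^sup>2 * s * u) * f + (c * u + a * b * s * u) * g"
    unfolding coupling_det_def e_def f_def g_def by (simp add: algebra_simps power2_eq_square)
  moreover have "coupling_det a b c s t u * r =
      (b * s + a * c * s * t) * e + (c * t + a * b * s * t) * f + (1 - a\<^sup>2 * s * t) * g"
    unfolding coupling_det_def e_def f_def g_def by (simp add: algebra_simps power2_eq_square)
  ultimately show ?thesis
    using nz by (auto simp: z)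
qed

lemma coupling_det_strict_antimono:
  assumes "a > 0" "b > 0" "c > 0"
    and "0 < s" "s < s'" "0 < t" "t < t'" "0 < u" "u < u'"
  shows "coupling_det a b c s' t' u' < coupling_det a b c s t u"
proof -
  have st: "s * t < s' * t'" and su: "s * u < s' * u'" and tu: "t * u < t' * u'"
    using assms by (simp_all add: mult_strict_mono)
  moreover have "s * t * u < s' * t' * u'"
    using st assms by (simp add: mult_strict_mono)
  ultimately have "a\<^sup>2 * (s * t) < a\<^sup>2 * (s' * t')" "b\<^sup>2 * (s * u) < b\<^sup>2 * (s' * u')"
    "c\<^sup>2 * (t * u) < c\<^sup>2 * (t' * u')"
    "2 * a * b * c * (s * t * u) < 2 * a * b * c * (s' * t' * u')"
    using assms(1-3) by (simp_all add: mult_strict_left_mono)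
  then show ?thesis
    unfolding coupling_det_def by linarith
qed

lemma cubic_system_unique:
  fixes a b c :: real
  assumes "a > 0" "b > 0" "c > 0"
    and x: "x1 > 0" "x2 > 0" "x3 > 0" and y: "y1 > 0" "y2 > 0" "y3 > 0"
    and x_eqs: "x1 = a * x2 ^ 3 + b * x3 ^ 3" "x2 = a * x1 ^ 3 + c * x3 ^ 3"
      "x3 = b * x1 ^ 3 + c * x2 ^ 3"
    and y_eqs: "y1 = a * y2 ^ 3 + b * y3 ^ 3" "y2 = a * y1 ^ 3 + c * y3 ^ 3"
      "y3 = b * y1 ^ 3 + c * y2 ^ 3"
  shows "x1 = y1 \<and> x2 = y2 \<and> x3 = y3"
proof (rule ccontr)
  assume neq: "\<not> (x1 = y1 \<and> x2 = y2 \<and> x3 = y3)"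
  define S :: "real \<Rightarrow> real \<Rightarrow> real" where "S v w = v\<^sup>2 + v * w + w\<^sup>2" for v w
  have S_diff: "S v w * (v - w) = v ^ 3 - w ^ 3" for v w
    unfolding S_def by (simp add: algebra_simps power2_eq_square power3_eq_cube)
  have cube: "v\<^sup>2 * v = v ^ 3" for v :: real
    by (simp add: power2_eq_square power3_eq_cube)
  have S_gt: "v\<^sup>2 < S v w" if "v > 0" "w > 0" for v w
    using that by (simp add: S_def add_pos_pos)
  have "coupling_det a b c (x1\<^sup>2) (x2\<^sup>2) (x3\<^sup>2) = 0"
    by (rule coupling_det_eq_0[of x1 _ _ x2 _ _ x3], unfold cube) (use x in \<open>(intro x_eqs | simp)+\<close>)
  moreover have "coupling_det a b c (S x1 y1) (S x2 y2) (S x3 y3) = 0"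
  proof (rule coupling_det_eq_0[of "x1 - y1" _ _ "x2 - y2" _ _ "x3 - y3"], unfold S_diff)
    show "x1 - y1 = a * (x2 ^ 3 - y2 ^ 3) + b * (x3 ^ 3 - y3 ^ 3)"
      using x_eqs(1) y_eqs(1) by (simp add: right_diff_distrib)
    show "x2 - y2 = a * (x1 ^ 3 - y1 ^ 3) + c * (x3 ^ 3 - y3 ^ 3)"
      using x_eqs(2) y_eqs(2) by (simp add: right_diff_distrib)
    show "x3 - y3 = b * (x1 ^ 3 - y1 ^ 3) + c * (x2 ^ 3 - y2 ^ 3)"
      using x_eqs(3) y_eqs(3) by (simp add: right_diff_distrib)
  qed (use neq in auto)
  moreover have "coupling_det a b c (S x1 y1) (S x2 y2) (S x3 y3)
      < coupling_det a b c (x1\<^sup>2) (x2\<^sup>2) (x3\<^sup>2)"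
    by (rule coupling_det_strict_antimono) (use assms(1-3) x y in \<open>auto intro: S_gt\<close>)
  ultimately show False
    by simp
qed

lemma solutions_empty:
  fixes z :: "'k::finite \<Rightarrow> real^5"
  assumes "kappa \<le> 0"
  shows "solutions z = {}"
proof -
  have False if "x \<in> solutions z" for x
  proof -
    fix k
    have pos: "x $ j > 0" for j
      using that by (simp add: solutions_def)
    have "(\<Sum>j\<in>UNIV - {k}. norm (z j - z k) powi (-3) * (x $ j) ^ 3) \<ge> 0"
      by (intro sum_nonneg mult_nonneg_nonneg zero_le_power_int) (auto simp: less_imp_le pos)
    then have "6 * x $ k \<le> 0"
      using that assms by (auto simp: solutions_def mult_nonpos_nonneg)
    with pos[of k] show False
      by simp
  qed
  then show ?thesis
    by blast
qed

lemma solutions_3_eqs: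
  fixes z :: "3 \<Rightarrow> real^5" and x :: "real^3"
  defines "A \<equiv> \<lambda>i j. kappa / 6 * norm (z i - z j) powi (-3)"
  assumes "x \<in> solutions z"
  shows "x $ 1 = A 1 2 * (x $ 2) ^ 3 + A 1 3 * (x $ 3) ^ 3"
    and "x $ 2 = A 1 2 * (x $ 1) ^ 3 + A 2 3 * (x $ 3) ^ 3"
    and "x $ 3 = A 1 3 * (x $ 1) ^ 3 + A 2 3 * (x $ 2) ^ 3"
proof -
  have eq: "6 * x $ k =
      kappa * (\<Sum>j\<in>UNIV - {k}. norm (z j - z k) powi (-3) * (x $ j) ^ 3)" for k
    using assms(2) by (simp add: solutions_def)
  have others: "UNIV - {1} = {2, 3::3}" "UNIV - {2} = {1, 3::3}" "UNIV - {3} = {1, 2::3}"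
    unfolding UNIV_3 by auto
  show "x $ 1 = A 1 2 * (x $ 2) ^ 3 + A 1 3 * (x $ 3) ^ 3"
    using eq[of 1] by (simp add: others A_def norm_minus_commute algebra_simps)
  show "x $ 2 = A 1 2 * (x $ 1) ^ 3 + A 2 3 * (x $ 3) ^ 3"
    using eq[of 2] by (simp add: others A_def norm_minus_commute algebra_simps)
  show "x $ 3 = A 1 3 * (x $ 1) ^ 3 + A 2 3 * (x $ 2) ^ 3"
    using eq[of 3] by (simp add: others A_def norm_minus_commute algebra_simps)
qed

lemma solutions_3_unique:
  fixes z :: "3 \<Rightarrow> real^5"
  assumes "inj z" and x: "x \<in> solutions z" and y: "y \<in> solutions z"
  shows "x = y"
proof -
  have "kappa > 0"
    using solutions_empty[of z] x by force
  then have A_pos: "kappa / 6 * norm (z i - z j) powi (-3) > 0" if "i \<noteq> j" for i j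
    using that injD[OF \<open>inj z\<close>, of i j] by (intro mult_pos_pos zero_less_power_int) auto
  have "x $ 1 = y $ 1 \<and> x $ 2 = y $ 2 \<and> x $ 3 = y $ 3"
    by (rule cubic_system_unique[OF A_pos[of 1 2] A_pos[of 1 3] A_pos[of 2 3] _ _ _ _ _ _
          solutions_3_eqs[OF x] solutions_3_eqs[OF y]])
      (use x y in \<open>auto simp: solutions_def\<close>)
  then show ?thesis
    by (simp add: vec_eq_iff forall_3)
qed

theorem propositionA1:
  fixes z :: "3 \<Rightarrow> real^5"
  assumes "inj z"
  shows "discrete (solutions z)"
proof -
  have "x isolated_in solutions z" if "x \<in> solutions z" for x
    unfolding isolated_in_def
    using that solutions_3_unique[OF assms] by (intro conjI exI[of _ UNIV]) auto
  then show ?thesis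
    by (simp add: discrete_def)
qed

end
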